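(* Let $N\ge 1$ be an integer, let $k$ be an even positive integer, and let $f=\sum_{n=1}^{\infty}a_f(n)q^n\in S_k(N,\chi)$ be a primitive form of weight $k$, level $N$, with character $\chi$. Assume that $\chi$ is trivial and that $a_f(n)\in\mathbb{Z}$ for all $n\ge 1$. Then there exists an integer $M_f\ge 1$ with $\gcd(M_f,N)=1$ and $M_f\mid 6$ such that for every prime $p\nmid M_f$, either $a_f(p)=0$ or $a_f(p^r)\neq 0$ for all $r\ge 1$.
   Context: Here $q=e^{2\pi i\tau}$ with $\tau$ in the complex upper half plane. For a Dirichlet character $\chi$ modulo $N$, $S_k(N,\chi)$ is the space of cusp forms $f$ of weight $k$ on $\Gamma_1(N)$ satisfying $f|_k\gamma=\chi(d)f$ for all $\gamma=\begin{pmatrix}a&b\\c&d\end{pmatrix}\in\Gamma_0(N)$, where $(f|_k\gamma)(\tau)=(c\tau+d)^{-k}f(\gamma\tau)$. A primitive form of weight $k$, level $N$, with character $\chi$ is a normalized newform: an element $f$ of $S_k(N,\chi)$ lying in the new subspace $S_k(\Gamma_1(N))^{\mathrm{new}}$ (the orthogonal complement, for the Petersson inner product, of the space of old forms), which is an eigenform of the Hecke operators $T_n$ and diamond operators $\langle n\rangle$ for all $n\in\mathbb{N}$, and which satisfies $a_f(1)=1$. *)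

theory Defs
  imports "HOL-Complex_Analysis.Complex_Analysis" "HOL-Number_Theory.Number_Theory"
begin

(* Functions on the upper half plane are total functions on the complex numbers;
   all conditions below only concern their values on this set. *)
definition upper_half_plane :: "complex set" where
  "upper_half_plane = {\<tau>. 0 < Im \<tau>}"


subsection \<open>Congruence subgroups and the weight-\<open>k\<close> action\<close>

definition SL2Z :: "(int^2^2) set" where
  "SL2Z = {A. det A = 1}"

definition Gamma0 :: "nat \<Rightarrow> (int^2^2) set" where
  "Gamma0 N = {A \<in> SL2Z. [A $ 2 $ 1 = 0] (mod int N)}"

definition Gamma1 :: "nat \<Rightarrow> (int^2^2) set" where
  "Gamma1 N = {A \<in> SL2Z. [A $ 1 $ 1 = 1] (mod int N) \<and> [A $ 2 $ 2 = 1] (mod int N) \<and>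
                 [A $ 2 $ 1 = 0] (mod int N)}"

definition moebius_act :: "int^2^2 \<Rightarrow> complex \<Rightarrow> complex" where
  "moebius_act A \<tau> =
     (of_int (A $ 1 $ 1) * \<tau> + of_int (A $ 1 $ 2)) / (of_int (A $ 2 $ 1) * \<tau> + of_int (A $ 2 $ 2))"

(* The factor \<open>det A ^ (k - 1)\<close>, which is 1 on SL2Z, is the usual normalisation of the
   action of integer matrices of positive determinant in the theory of Hecke operators. *)
definition slash :: "nat \<Rightarrow> int^2^2 \<Rightarrow> (complex \<Rightarrow> complex) \<Rightarrow> complex \<Rightarrow> complex" where
  "slash k A f \<tau> = of_int (det A) powi (int k - 1) *
     (of_int (A $ 2 $ 1) * \<tau> + of_int (A $ 2 $ 2)) powi (- int k) * f (moebius_act A \<tau>)"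

(* The classes of this relation on X are the left cosets H \<alpha>, i.e. \<open>X // left_coset_rel H X\<close>
   is the set H\X whenever the group H acts on X by multiplication from the left. *)
definition left_coset_rel :: "(int^2^2) set \<Rightarrow> (int^2^2) set \<Rightarrow> ((int^2^2) \<times> (int^2^2)) set" where
  "left_coset_rel H X = {(A, B) \<in> X \<times> X. \<exists>\<gamma>\<in>H. B = \<gamma> ** A}"

(* Sum of \<phi> over a system of representatives of H\X; only meaningful for \<phi> invariant under
   multiplication by H from the left. *)
definition coset_sum ::
    "(int^2^2) set \<Rightarrow> (int^2^2) set \<Rightarrow> (int^2^2 \<Rightarrow> complex) \<Rightarrow> complex" where
  "coset_sum H X \<phi> = (\<Sum>C\<in>X // left_coset_rel H X. \<phi> (SOME A. A \<in> C))"


subsection \<open>Cusp forms and Fourier expansions\<close>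

(* The local parameter \<open>e^(2 \<pi> i \<tau> / h)\<close>. *)
definition q_param :: "nat \<Rightarrow> complex \<Rightarrow> complex" where
  "q_param h \<tau> = exp (2 * of_real pi * \<i> * \<tau> / of_nat h)"

definition has_q_expansion :: "nat \<Rightarrow> (complex \<Rightarrow> complex) \<Rightarrow> (nat \<Rightarrow> complex) \<Rightarrow> bool" where
  "has_q_expansion h f a \<longleftrightarrow>
     (\<forall>\<tau>\<in>upper_half_plane. (\<lambda>n. a n * q_param h \<tau> ^ n) sums f \<tau>)"

(* The cusp condition is imposed on f|\<alpha> for all \<alpha> in SL2Z; each f|\<alpha> has period N. *)
definition cusp_forms :: "nat \<Rightarrow> nat \<Rightarrow> (complex \<Rightarrow> complex) set" where
  "cusp_forms k N = {f. f holomorphic_on upper_half_plane \<and>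
     (\<forall>\<gamma>\<in>Gamma1 N. \<forall>\<tau>\<in>upper_half_plane. slash k \<gamma> f \<tau> = f \<tau>) \<and>
     (\<forall>\<alpha>\<in>SL2Z. \<exists>a. a 0 = 0 \<and> has_q_expansion N (slash k \<alpha> f) a)}"

definition dirichlet_character :: "nat \<Rightarrow> (int \<Rightarrow> complex) \<Rightarrow> bool" where
  "dirichlet_character N \<psi> \<longleftrightarrow>
     (\<forall>m n. [m = n] (mod int N) \<longrightarrow> \<psi> m = \<psi> n) \<and>
     (\<forall>m n. \<psi> (m * n) = \<psi> m * \<psi> n) \<and>
     (\<forall>n. \<psi> n \<noteq> 0 \<longleftrightarrow> coprime n (int N))"

definition trivial_character :: "nat \<Rightarrow> int \<Rightarrow> complex" where
  "trivial_character N n = (if coprime n (int N) then 1 else 0)"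

definition cusp_forms_char :: "nat \<Rightarrow> nat \<Rightarrow> (int \<Rightarrow> complex) \<Rightarrow> (complex \<Rightarrow> complex) set" where
  "cusp_forms_char k N \<psi> = {f \<in> cusp_forms k N.
     \<forall>\<gamma>\<in>Gamma0 N. \<forall>\<tau>\<in>upper_half_plane. slash k \<gamma> f \<tau> = \<psi> (\<gamma> $ 2 $ 2) * f \<tau>}"

definition fourier_coeff :: "(complex \<Rightarrow> complex) \<Rightarrow> nat \<Rightarrow> complex" where
  "fourier_coeff f = (THE a. has_q_expansion 1 f a)"


lemma q_param_surj:
  assumes "N \<ge> 1" "norm x < 1" "x \<noteq> 0"
  shows "\<exists>\<tau>\<in>upper_half_plane. q_param N \<tau> = x"
proof
  let ?t = "of_nat N * Ln x / (2 * of_real pi * \<i>)"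
  have e: "?t = - (\<i> * (of_real (real N) * Ln x) / of_real (2*pi))"
    by (simp add: field_simps)
  have "Im ?t = - (real N * Re (Ln x) / (2*pi))"
    unfolding e by simp
  moreover have "Re (Ln x) < 0" using assms by (simp add: Re_Ln)
  ultimately show "?t \<in> upper_half_plane"
    using assms(1) by (simp add: upper_half_plane_def divide_neg_pos mult_pos_neg)
  show "q_param N ?t = x" using assms by (simp add: q_param_def exp_Ln)
qed

lemma has_q_expansion_unique:
  assumes "N \<ge> 1" "has_q_expansion N f a" "has_q_expansion N f b"
  shows "a = b"
proof (rule ccontr)
  let ?c = "\<lambda>n. a n - b n"
  assume "a \<noteq> b"
  then obtain m' where m': "a m' \<noteq> b m'" by blast
  define m where "m = (LEAST m. a m \<noteq> b m)"
  have m: "a m \<noteq> b m" unfolding m_def using m' by (rule LeastI)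
  have ml: "a i = b i" if "i < m" for i
    using that not_less_Least unfolding m_def by blast
  have z: "(\<lambda>n. ?c n * x ^ n) sums 0" if x: "x \<noteq> 0" "norm x < 1" for x
  proof -
    obtain t where t: "t \<in> upper_half_plane" "q_param N t = x"
      using q_param_surj[OF assms(1) x(2,1)] by blast
    have "(\<lambda>n. a n * x ^ n - b n * x ^ n) sums (f t - f t)"
      using assms(2,3) t unfolding has_q_expansion_def by (intro sums_diff) auto
    then show ?thesis by (simp add: algebra_simps)
  qed
  have s: "(\<lambda>n. ?c (n + m) * x ^ n) sums (if x = 0 then ?c m else 0)" if "norm x < 1" for x
  proof (cases "x = 0")
    case True
    then show ?thesis using powser_sums_zero[of "\<lambda>n. ?c (n + m)"] by simp
  next
    case False
    have "(\<lambda>n. ?c (n + m) * x ^ (n + m)) sums (0 - (\<Sum>i<m. ?c i * x ^ i))"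
      using z[OF False that] by (subst sums_iff_shift) auto
    then have "(\<lambda>n. ?c (n + m) * x ^ (n + m)) sums 0" using ml by simp
    then have "(\<lambda>n. ?c (n + m) * x ^ (n + m) / x ^ m) sums (0 / x ^ m)" by (rule sums_divide)
    then show ?thesis using False by (simp add: power_add)
  qed
  have "isCont (\<lambda>x. \<Sum>n. ?c (n + m) * x ^ n) 0"
    using s[of "1/2"] by (intro isCont_powser[of _ "1/2"]) (auto simp: sums_iff norm_divide)
  then have "((\<lambda>x. \<Sum>n. ?c (n + m) * x ^ n) \<longlongrightarrow> ?c m) (at 0)"
    using s[of 0] by (simp add: isCont_def sums_iff)
  moreover have "\<forall>\<^sub>F x in at 0. (\<Sum>n. ?c (n + m) * x ^ n) = 0"
    unfolding eventually_at by (rule exI[of _ 1]) (use s in \<open>auto simp: sums_iff\<close>)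
  ultimately have "((\<lambda>x. 0) \<longlongrightarrow> ?c m) (at (0::complex))"
    by (rule Lim_transform_eventually)
  then show False using m
    by (metis LIM_const_eq eq_iff_diff_eq_0)
qed

lemma fourier_coeff_eqI: "has_q_expansion 1 f a \<Longrightarrow> fourier_coeff f = a"
  unfolding fourier_coeff_def using has_q_expansion_unique[of 1] by blast

lemma cusp_form_q_expansion:
  assumes "N \<ge> 1" "f \<in> cusp_forms k N"
  shows "has_q_expansion 1 f (fourier_coeff f)" "fourier_coeff f 0 = 0"
proof -
  have one: "mat 1 \<in> SL2Z" by (simp add: SL2Z_def)
  have sl1: "slash k (mat 1) f = f"
    by (rule ext) (simp add: slash_def mat_def det_2 moebius_act_def)
  obtain b where b: "b 0 = 0" "has_q_expansion N f b"
    using assms(2) one sl1 unfolding cusp_forms_def by force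
  define T :: "int^2^2" where "T = vector [vector [1, 1], vector [0, 1]]"
  have T: "T $ 1 $ 1 = 1" "T $ 1 $ 2 = 1" "T $ 2 $ 1 = 0" "T $ 2 $ 2 = 1"
    by (simp_all add: T_def)
  have "T \<in> Gamma1 N" by (simp add: Gamma1_def SL2Z_def det_2 T)
  then have per: "f (\<tau> + 1) = f \<tau>" if "\<tau> \<in> upper_half_plane" for \<tau>
    using assms(2) that unfolding cusp_forms_def
    by (force simp: slash_def det_2 T moebius_act_def)
  define w where "w = q_param N 1"
  have q1: "q_param N (\<tau> + 1) = w * q_param N \<tau>" for \<tau>
    by (simp add: w_def q_param_def add_divide_distrib ring_distribs exp_add mult.commute)
  have "has_q_expansion N f (\<lambda>n. b n * w ^ n)"
    unfolding has_q_expansion_def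
  proof
    fix \<tau> assume t: "\<tau> \<in> upper_half_plane"
    then have "\<tau> + 1 \<in> upper_half_plane" by (simp add: upper_half_plane_def)
    then have "(\<lambda>n. b n * q_param N (\<tau> + 1) ^ n) sums f (\<tau> + 1)"
      using b(2) unfolding has_q_expansion_def by blast
    then show "(\<lambda>n. b n * w ^ n * q_param N \<tau> ^ n) sums f \<tau>"
      using per[OF t] by (simp add: q1 power_mult_distrib mult.assoc)
  qed
  then have bw: "b n * w ^ n = b n" for n
    using has_q_expansion_unique[OF assms(1) b(2)] by metis
  have wn: "w ^ n = 1 \<longleftrightarrow> N dvd n" for n
  proof -
    have "w ^ n = exp (2 * of_real pi * \<i> * of_nat n / of_nat N)"
      by (simp add: w_def q_param_def exp_of_nat_mult[symmetric] mult_ac)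
    then show ?thesis using complex_root_unity_eq_1[of N n] assms(1)
      by (simp add: mult_ac)
  qed
  have b0: "b n = 0" if "\<not> N dvd n" for n using bw[of n] wn[of n] that by auto
  have "has_q_expansion 1 f (\<lambda>n. b (N * n))"
    unfolding has_q_expansion_def
  proof
    fix \<tau> assume t: "\<tau> \<in> upper_half_plane"
    have "q_param 1 \<tau> = q_param N \<tau> ^ N"
      using assms(1) by (simp add: q_param_def exp_of_nat_mult[symmetric])
    then have "(\<lambda>n. b (N * n) * q_param 1 \<tau> ^ n) = (\<lambda>n. b (N * n) * q_param N \<tau> ^ (N * n))"
      by (simp add: power_mult)
    moreover have "(\<lambda>n. b (N * n) * q_param N \<tau> ^ (N * n)) sums f \<tau>
        \<longleftrightarrow> (\<lambda>n. b n * q_param N \<tau> ^ n) sums f \<tau>"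
      using assms(1) b0
      by (intro sums_mono_reindex[of "\<lambda>n. N * n" "\<lambda>n. b n * q_param N \<tau> ^ n"])
         (auto simp: strict_mono_def elim!: dvdE)
    ultimately show "(\<lambda>n. b (N * n) * q_param 1 \<tau> ^ n) sums f \<tau>"
      using b(2) t unfolding has_q_expansion_def by simp
  qed
  moreover from this have "fourier_coeff f = (\<lambda>n. b (N * n))" by (rule fourier_coeff_eqI)
  ultimately show "has_q_expansion 1 f (fourier_coeff f)" "fourier_coeff f 0 = 0"
    using b(1) by simp_all
qed


subsection \<open>Hecke and diamond operators\<close>

definition diamond_op :: "nat \<Rightarrow> nat \<Rightarrow> nat \<Rightarrow> (complex \<Rightarrow> complex) \<Rightarrow> complex \<Rightarrow> complex" where
  "diamond_op k N n f =
     (if coprime n N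
      then slash k (SOME \<alpha>. \<alpha> \<in> Gamma0 N \<and> [\<alpha> $ 2 $ 2 = int n] (mod int N)) f
      else (\<lambda>_. 0))"

(* All integer matrices of determinant n congruent to (1 *; 0 n) modulo N. For a prime p this is
   the double coset Gamma1(N) diag(1,p) Gamma1(N). *)
definition hecke_matrices :: "nat \<Rightarrow> nat \<Rightarrow> (int^2^2) set" where
  "hecke_matrices N n = {A. det A = int n \<and> [A $ 1 $ 1 = 1] (mod int N) \<and>
     [A $ 2 $ 1 = 0] (mod int N) \<and> [A $ 2 $ 2 = int n] (mod int N)}"

(* T_n for every n \<ge> 1, including n not coprime to N (so this is U_p for a prime p dividing N).
   These operators satisfy T_m T_n = T_(mn) for coprime m, n and
   T_(p^(r+2)) = T_p T_(p^(r+1)) - p^(k-1) <p> T_(p^r). *)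
definition hecke_op :: "nat \<Rightarrow> nat \<Rightarrow> nat \<Rightarrow> (complex \<Rightarrow> complex) \<Rightarrow> complex \<Rightarrow> complex" where
  "hecke_op k N n f \<tau> = coset_sum (Gamma1 N) (hecke_matrices N n) (\<lambda>A. slash k A f \<tau>)"


subsection \<open>Petersson inner product, old forms and newforms\<close>

definition SL2Z_fundamental_domain :: "complex set" where
  "SL2Z_fundamental_domain = {\<tau> \<in> upper_half_plane. \<bar>Re \<tau>\<bar> \<le> 1 / 2 \<and> 1 \<le> norm \<tau>}"

(* The integral of f(z) cnj(g(z)) y^k over Gamma1(N)\H with respect to dx dy / y^2, a fundamental domain
   being the union of the translates of the one of SL2Z by representatives of
   {1,-1}Gamma1(N)\SL2Z. It is not divided by the volume, which is irrelevant for
   orthogonality. *)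
definition petersson ::
    "nat \<Rightarrow> nat \<Rightarrow> (complex \<Rightarrow> complex) \<Rightarrow> (complex \<Rightarrow> complex) \<Rightarrow> complex" where
  "petersson k N f g = coset_sum (Gamma1 N \<union> uminus ` Gamma1 N) SL2Z
     (\<lambda>\<alpha>. set_lebesgue_integral lborel SL2Z_fundamental_domain
        (\<lambda>\<tau>. let z = moebius_act \<alpha> \<tau>
              in f z * cnj (g z) * of_real (Im z ^ k) / of_real (Im \<tau> ^ 2)))"

definition scaling_matrix :: "nat \<Rightarrow> int^2^2" where
  "scaling_matrix d = vector [vector [int d, 0], vector [0, 1]]"

(* The sum over all primes p dividing N of the images of the maps
   (g, h) \<mapsto> g + h|diag(p,1) from pairs of cusp forms of level N/p. *)
definition old_forms :: "nat \<Rightarrow> nat \<Rightarrow> (complex \<Rightarrow> complex) set" where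
  "old_forms k N = {F. \<exists>g h.
     (\<forall>p\<in>prime_factors N. g p \<in> cusp_forms k (N div p) \<and> h p \<in> cusp_forms k (N div p)) \<and>
     (\<forall>\<tau>\<in>upper_half_plane.
        F \<tau> = (\<Sum>p\<in>prime_factors N. g p \<tau> + slash k (scaling_matrix p) (h p) \<tau>))}"

definition new_forms :: "nat \<Rightarrow> nat \<Rightarrow> (complex \<Rightarrow> complex) set" where
  "new_forms k N = {f \<in> cusp_forms k N. \<forall>F\<in>old_forms k N. petersson k N f F = 0}"

definition eigenform_of ::
    "((complex \<Rightarrow> complex) \<Rightarrow> complex \<Rightarrow> complex) \<Rightarrow> (complex \<Rightarrow> complex) \<Rightarrow> bool" where
  "eigenform_of T f \<longleftrightarrow> (\<exists>\<tau>\<in>upper_half_plane. f \<tau> \<noteq> 0) \<and>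
     (\<exists>c. \<forall>\<tau>\<in>upper_half_plane. T f \<tau> = c * f \<tau>)"

definition primitive_form :: "nat \<Rightarrow> nat \<Rightarrow> (int \<Rightarrow> complex) \<Rightarrow> (complex \<Rightarrow> complex) \<Rightarrow> bool" where
  "primitive_form k N \<psi> f \<longleftrightarrow> f \<in> cusp_forms_char k N \<psi> \<and> f \<in> new_forms k N \<and>
     (\<forall>n\<ge>1. eigenform_of (hecke_op k N n) f \<and> eigenform_of (diamond_op k N n) f) \<and>
     fourier_coeff f 1 = 1"

end

theory Submission imports Defs begin

text \<open>
  The eigenvalue of \<open>T\<^sub>p\<close> is \<open>a(p)\<close>, so \<open>a(p\<^sup>r)\<close> is \<open>a(p)\<^sup>r\<close> if \<open>p\<close> divides \<open>N\<close>, and otherwise the Lucas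
  sequence with parameters \<open>A = a(p)\<close> and \<open>P = p^(k - 1)\<close>. Suppose \<open>A \<noteq> 0\<close> in the latter case. The
  exponent \<open>k - 1\<close> is odd, so it is not twice the \<open>p\<close>-adic valuation \<open>v\<close> of \<open>A\<close>. If \<open>2 v < k - 1\<close>, the
  term \<open>A u\<^sub>r\<close> dominates \<open>p\<close>-adically and \<open>u\<^sub>r\<close> has valuation \<open>v r\<close>. If \<open>2 v > k - 1\<close>, then \<open>A\<^sup>2\<close> is
  a nonzero multiple of \<open>p P\<close>, so for \<open>p \<ge> 4\<close> the polynomial \<open>X\<^sup>2 - A X + P\<close> has real roots and \<open>u\<^sub>r\<close> cannot
  vanish. Only the primes 2 and 3 are left, and \<open>M\<close> is the product of those among them that do not
  divide \<open>N\<close>.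
\<close>

(* The matrix entries below would parse ambiguously, as fps_nth is written with the same symbol. *)
no_notation fps_nth (infixl \<open>$\<close> 75)

subsection \<open>Zeros of Lucas sequences\<close>

text \<open>Since \<open>2 * v < e\<close>, the summand \<open>A * u (r + 1)\<close> always has
  strictly smaller \<open>p\<close>-adic valuation than \<open>p ^ e * u r\<close>, so nothing
  cancels. The recurrence has order two, so the induction tracks the exact valuations of two
  consecutive terms.\<close>

lemma lucas_nonzero_of_small_valuation:
  fixes u :: "nat \<Rightarrow> int" and A B p :: int
  assumes "prime p" "\<not> p dvd B" "A = p ^ v * B" "2 * v < e"
    and u0: "u 0 = 1" and u1: "u 1 = A"
    and rec: "\<And>r. u (r + 2) = A * u (r + 1) - p ^ e * u r"
  shows "u r \<noteq> 0"
proof -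
  have "\<exists>w w'. u r = p ^ (v * r) * w \<and> u (Suc r) = p ^ (v * Suc r) * w' \<and>
          \<not> p dvd w \<and> \<not> p dvd w'"
  proof (induction r)
    case 0
    show ?case
      using assms u0 u1 by (intro exI[of _ 1] exI[of _ B]) (auto simp: not_prime_unit)
  next
    case (Suc r)
    then obtain w w' where w: "u r = p ^ (v * r) * w" "u (Suc r) = p ^ (v * Suc r) * w'"
      "\<not> p dvd w" "\<not> p dvd w'" by blast
    \<comment> \<open>\<open>s\<close> is the excess of the valuation of \<open>p ^ e * u r\<close>
      over that of \<open>A * u (Suc r)\<close>.\<close>
    define s where "s = e - 2 * v"
    have e: "e = v + v + s" and s: "s > 0" using assms(4) by (auto simp: s_def)
    have "u (Suc (Suc r)) = p ^ (v * Suc (Suc r)) * (B * w' - p ^ s * w)"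
      using rec[of r] w assms(3) by (simp add: e power_add algebra_simps)
    moreover have "\<not> p dvd B * w' - p ^ s * w"
    proof
      assume "p dvd B * w' - p ^ s * w"
      moreover have "p dvd p ^ s * w" using s by simp
      ultimately have "p dvd B * w'" by (metis diff_add_cancel dvd_add)
      then show False using assms(1,2) w(4) prime_dvd_mult_iff by blast
    qed
    ultimately show ?case using w by blast
  qed
  then show ?thesis using assms(1) by auto
qed

text \<open>The bound on \<open>P\<close> says that \<open>X^2 - A X + P\<close> has nonnegative
  discriminant. If the ratio \<open>t\<close> of consecutive absolute values is at least
  \<open>|A| / 2\<close>, the next one is at least \<open>|A| - P / t\<close>, which is again at
  least \<open>|A| / 2\<close>.\<close>

lemma lucas_nonzero_of_real_roots:
  fixes u :: "nat \<Rightarrow> int" and A P :: int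
  assumes "A \<noteq> 0" "P \<ge> 0" "4 * P \<le> A\<^sup>2"
    and u0: "u 0 = 1" and u1: "u 1 = A"
    and rec: "\<And>r. u (r + 2) = A * u (r + 1) - P * u r"
  shows "u r \<noteq> 0"
proof -
  \<comment> \<open>The double root \<open>A / 2\<close> of the extremal case bounds the growth rate from below.\<close>
  have "u r \<noteq> 0 \<and> \<bar>A\<bar> * \<bar>u r\<bar> \<le> 2 * \<bar>u (Suc r)\<bar>"
  proof (induction r)
    case 0
    show ?case using u0 u1 by simp
  next
    case (Suc r)
    let ?a = "\<bar>A\<bar>" and ?x = "\<bar>u r\<bar>" and ?y = "\<bar>u (Suc r)\<bar>" and ?z = "\<bar>u (Suc (Suc r))\<bar>"
    have a: "?a > 0" using assms(1) by simp
    have "0 < ?a * ?x" using Suc a by simp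
    then have y: "u (Suc r) \<noteq> 0" using Suc by auto
    have "?a * ?y = \<bar>u (Suc (Suc r)) + P * u r\<bar>"
      using rec[of r] by (simp add: abs_mult)
    also have "\<dots> \<le> ?z + P * ?x"
      using assms(2) by (metis abs_mult abs_of_nonneg abs_triangle_ineq)
    finally have 1: "?a * ?y \<le> ?z + P * ?x" .
    \<comment> \<open>Multiplying by \<open>?a\<close> lets the induction hypothesis apply without
      division; the factor is cancelled at the end.\<close>
    have "?a * (4 * (P * ?x)) = 4 * P * (?a * ?x)" by simp
    also have "\<dots> \<le> 4 * P * (2 * ?y)"
      using Suc assms(2) by (intro mult_left_mono) auto
    also have "\<dots> \<le> A\<^sup>2 * (2 * ?y)"
      using assms(3) by (intro mult_right_mono) auto
    also have "\<dots> = ?a * (?a * (2 * ?y))"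
      by (metis mult.assoc power2_abs power2_eq_square)
    finally have "4 * (P * ?x) \<le> ?a * (2 * ?y)" using a by simp
    then show ?case using 1 y by simp
  qed
  then show ?thesis by blast
qed

lemma lucas_nonzero:
  fixes u :: "nat \<Rightarrow> int" and A p :: int
  assumes p: "prime p" "p \<ge> 4" and e: "odd e" and A: "A \<noteq> 0"
    and u: "u 0 = 1" "u 1 = A" "\<And>r. u (r + 2) = A * u (r + 1) - p ^ e * u r"
  shows "u r \<noteq> 0"
proof -
  have "\<not> is_unit p" using p(1) not_prime_unit by blast
  then obtain B where B: "A = p ^ multiplicity p A * B" "\<not> p dvd B"
    using multiplicity_decompose'[OF A, of p] by metis
  define v where "v = multiplicity p A"
  show ?thesis
  proof (cases "2 * v < e")
    case True
    then show ?thesis using lucas_nonzero_of_small_valuation[of p B A v e u r] p B u v_def by auto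
  next
    case False
    \<comment> \<open>Equality is excluded by parity, so \<open>A^2\<close> contains at least one
      factor \<open>p\<close> more than \<open>p ^ e\<close>.\<close>
    then have "e < 2 * v" using e by (metis dvd_triv_left linorder_neqE_nat)
    then obtain s where s: "2 * v = e + Suc s" by (metis add_Suc_right less_iff_Suc_add)
    have "A\<^sup>2 = p ^ (2 * v) * B\<^sup>2"
      using B(1) by (metis mult.commute power_mult power_mult_distrib v_def)
    then have "A\<^sup>2 = p ^ e * (p * (p ^ s * B\<^sup>2))" by (simp add: s power_add)
    moreover have "B \<noteq> 0" using B(2) by auto
    then have "p ^ s * B\<^sup>2 > 0" using p(2) by (simp add: zero_less_mult_iff)
    then have "1 \<le> p ^ s * B\<^sup>2" by linarith
    then have "p * 1 \<le> p * (p ^ s * B\<^sup>2)"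
      using p(2) by (intro mult_left_mono) auto
    then have "4 \<le> p * (p ^ s * B\<^sup>2)" using p(2) by linarith
    then have "p ^ e * 4 \<le> p ^ e * (p * (p ^ s * B\<^sup>2))"
      using p(2) by (intro mult_left_mono zero_le_power) auto
    ultimately show ?thesis
      using lucas_nonzero_of_real_roots[of A "p ^ e" u r] A p(2) u by simp
  qed
qed

subsection \<open>Coset representatives for the Hecke operator at a prime\<close>

definition mat2 :: "'a \<Rightarrow> 'a \<Rightarrow> 'a \<Rightarrow> 'a \<Rightarrow> ('a::zero)^2^2" where
  "mat2 a b c d = vector [vector [a, b], vector [c, d]]"

lemma mat2_nth [simp]:
  "mat2 a b c d $ 1 $ 1 = a" "mat2 a b c d $ 1 $ 2 = b"
  "mat2 a b c d $ 2 $ 1 = c" "mat2 a b c d $ 2 $ 2 = d"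
  by (simp_all add: mat2_def)

lemma mat_mult_nth_2:
  fixes A B :: "('a::semiring_1)^2^2"
  shows "(A ** B) $ i $ j = A $ i $ 1 * B $ 1 $ j + A $ i $ 2 * B $ 2 $ j"
  by (simp add: matrix_matrix_mult_def sum_2)

lemma mat_eq_iff_2:
  fixes A B :: "'a^2^2"
  shows "A = B \<longleftrightarrow> A $ 1 $ 1 = B $ 1 $ 1 \<and> A $ 1 $ 2 = B $ 1 $ 2 \<and>
     A $ 2 $ 1 = B $ 2 $ 1 \<and> A $ 2 $ 2 = B $ 2 $ 2"
  by (auto simp: vec_eq_iff forall_2)

text \<open>Modulo \<open>N\<close> the determinant reduces to the lower right entry once the first
  column is \<open>(1, 0)\<close>.\<close>

lemma Gamma1_iff:
  "A \<in> Gamma1 N \<longleftrightarrow> det A = 1 \<and> [A $ 1 $ 1 = 1] (mod int N) \<and> [A $ 2 $ 1 = 0] (mod int N)"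
proof -
  have "[A $ 2 $ 2 = 1] (mod int N)"
    if "det A = 1" "[A $ 1 $ 1 = 1] (mod int N)" "[A $ 2 $ 1 = 0] (mod int N)"
  proof -
    have "[A $ 1 $ 1 * A $ 2 $ 2 - A $ 1 $ 2 * A $ 2 $ 1 = 1 * A $ 2 $ 2 - A $ 1 $ 2 * 0] (mod int N)"
      using that by (intro cong_diff cong_mult) auto
    then show ?thesis using that(1) by (simp add: det_2 cong_sym)
  qed
  then show ?thesis by (auto simp: Gamma1_def SL2Z_def)
qed

lemma Gamma1_one: "mat 1 \<in> Gamma1 N"
  by (simp add: Gamma1_iff) (simp add: mat_def)

lemma Gamma1_mult:
  assumes "A \<in> Gamma1 N" "B \<in> Gamma1 N"
  shows "A ** B \<in> Gamma1 N"
proof -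
  have "[A $ 1 $ 1 * B $ 1 $ 1 + A $ 1 $ 2 * B $ 2 $ 1 = 1 * 1 + A $ 1 $ 2 * 0] (mod int N)"
    "[A $ 2 $ 1 * B $ 1 $ 1 + A $ 2 $ 2 * B $ 2 $ 1 = 0 * 1 + A $ 2 $ 2 * 0] (mod int N)"
    using assms unfolding Gamma1_iff by (intro cong_add cong_mult; auto)+
  then show ?thesis using assms by (simp add: Gamma1_iff det_mul mat_mult_nth_2)
qed

lemma Gamma1_inverse:
  assumes "A \<in> Gamma1 N"
  shows "\<exists>B\<in>Gamma1 N. B ** A = mat 1"
proof
  let ?B = "mat2 (A $ 2 $ 2) (- A $ 1 $ 2) (- A $ 2 $ 1) (A $ 1 $ 1)"
  have "[- A $ 2 $ 1 = - 0] (mod int N)"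
    using assms by (subst cong_minus_minus_iff) (simp add: Gamma1_def)
  then show "?B \<in> Gamma1 N"
    using assms by (simp add: Gamma1_def SL2Z_def det_2 mult.commute)
  show "?B ** A = mat 1"
    using assms by (simp add: Gamma1_iff det_2 mat_eq_iff_2 mat_mult_nth_2 algebra_simps)
      (simp add: mat_def algebra_simps)
qed

text \<open>This trades the arbitrary choice in \<open>coset_sum\<close> for an explicit transversal
  \<open>R\<close>: by invariance under \<open>H\<close>, the chosen element of a class gives the
  same value as the member of \<open>R\<close> in that class.\<close>

lemma coset_sum_eq_sum:
  assumes one: "mat 1 \<in> H"
    and mult: "\<And>A B. A \<in> H \<Longrightarrow> B \<in> H \<Longrightarrow> A ** B \<in> H"
    and inverse: "\<And>A. A \<in> H \<Longrightarrow> \<exists>B\<in>H. B ** A = mat 1"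
    and R: "R \<subseteq> X" "\<And>A. A \<in> X \<Longrightarrow> \<exists>r\<in>R. \<exists>\<gamma>\<in>H. A = \<gamma> ** r"
      "\<And>r r' \<gamma>. r \<in> R \<Longrightarrow> r' \<in> R \<Longrightarrow> \<gamma> \<in> H \<Longrightarrow> r' = \<gamma> ** r \<Longrightarrow> r = r'"
    and inv: "\<And>\<gamma> A. \<gamma> \<in> H \<Longrightarrow> A \<in> X \<Longrightarrow> \<phi> (\<gamma> ** A) = \<phi> A"
  shows "coset_sum H X \<phi> = sum \<phi> R"
proof -
  let ?E = "left_coset_rel H X"
  have E: "equiv X ?E"
  proof (rule equivI)
    show "?E \<subseteq> X \<times> X" by (auto simp: left_coset_rel_def)
    show "refl_on X ?E" using one by (force simp: left_coset_rel_def refl_on_def)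
    show "sym ?E"
    proof (rule symI)
      fix A B assume "(A, B) \<in> ?E"
      then obtain \<gamma> where \<gamma>: "A \<in> X" "B \<in> X" "\<gamma> \<in> H" "B = \<gamma> ** A"
        by (auto simp: left_coset_rel_def)
      obtain \<delta> where \<delta>: "\<delta> \<in> H" "\<delta> ** \<gamma> = mat 1" using inverse[OF \<gamma>(3)] by blast
      have "A = \<delta> ** B" using \<gamma>(4) \<delta>(2) by (simp add: matrix_mul_assoc)
      then show "(B, A) \<in> ?E" using \<gamma> \<delta> by (auto simp: left_coset_rel_def)
    qed
    show "trans ?E"
      by (rule transI) (auto simp: left_coset_rel_def matrix_mul_assoc intro: mult)
  qed
  have rep: "\<phi> (SOME B. B \<in> ?E `` {A}) = \<phi> A" if "A \<in> X" for A
  proof -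
    have "A \<in> ?E `` {A}" using that equiv_class_self[OF E] by blast
    then have "(SOME B. B \<in> ?E `` {A}) \<in> ?E `` {A}" by (rule someI)
    then show ?thesis using inv by (auto simp: left_coset_rel_def)
  qed
  have "bij_betw (\<lambda>r. ?E `` {r}) R (X // ?E)"
    unfolding bij_betw_def
  proof
    show "inj_on (\<lambda>r. ?E `` {r}) R"
    proof (rule inj_onI)
      fix r r' assume r: "r \<in> R" "r' \<in> R" "?E `` {r} = ?E `` {r'}"
      then have "(r, r') \<in> ?E" using R(1) eq_equiv_class_iff[OF E] by blast
      then show "r = r'" using R(3) r by (auto simp: left_coset_rel_def)
    qed
    show "(\<lambda>r. ?E `` {r}) ` R = X // ?E"
    proof
      show "(\<lambda>r. ?E `` {r}) ` R \<subseteq> X // ?E" using R(1) by (auto intro: quotientI)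
      show "X // ?E \<subseteq> (\<lambda>r. ?E `` {r}) ` R"
      proof
        fix C assume "C \<in> X // ?E"
        then obtain A where A: "A \<in> X" "C = ?E `` {A}" by (auto elim: quotientE)
        obtain r \<gamma> where r: "r \<in> R" "\<gamma> \<in> H" "A = \<gamma> ** r" using R(2)[OF A(1)] by blast
        then have "(r, A) \<in> ?E" using A R(1) by (auto simp: left_coset_rel_def)
        then have "?E `` {r} = C" using A(2) equiv_class_eq[OF E] by blast
        then show "C \<in> (\<lambda>r. ?E `` {r}) ` R" using r by blast
      qed
    qed
  qed
  then have "coset_sum H X \<phi> = (\<Sum>r\<in>R. \<phi> (SOME B. B \<in> ?E `` {r}))"
    unfolding coset_sum_def by (rule sum.reindex_bij_betw[symmetric])
  also have "\<dots> = sum \<phi> R" using rep R(1) by (intro sum.cong) auto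
  finally show ?thesis .
qed

section \<open>The slash action of integer matrices of positive determinant\<close>

lemma moebius_denominator_nonzero:
  fixes A :: "int^2^2"
  assumes "det A > 0" "\<tau> \<in> upper_half_plane"
  shows "of_int (A $ 2 $ 1) * \<tau> + of_int (A $ 2 $ 2) \<noteq> 0"
proof
  assume z: "of_int (A $ 2 $ 1) * \<tau> + of_int (A $ 2 $ 2) = 0"
  then have "Im (of_int (A $ 2 $ 1) * \<tau> + of_int (A $ 2 $ 2)) = 0" by simp
  then have "A $ 2 $ 1 = 0" using assms(2) by (simp add: upper_half_plane_def)
  moreover from this z have "A $ 2 $ 2 = 0" by simp
  ultimately show False using assms(1) by (simp add: det_2)
qed

lemma moebius_act_upper_half_plane:
  assumes "det A > 0" "\<tau> \<in> upper_half_plane"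
  shows "moebius_act A \<tau> \<in> upper_half_plane"
proof -
  let ?w = "of_int (A $ 2 $ 1) * \<tau> + of_int (A $ 2 $ 2)"
  have "Im (moebius_act A \<tau>) = of_int (det A) * Im \<tau> / (cmod ?w)\<^sup>2"
    unfolding moebius_act_def Im_divide cmod_power2 by (simp add: det_2 algebra_simps)
  then show ?thesis
    using assms moebius_denominator_nonzero[OF assms] by (simp add: upper_half_plane_def)
qed

text \<open>The automorphy factor \<open>?j\<close> is a cocycle, and the numerator
  \<open>?n\<close> transforms by the same factor, which cancels in the quotient.\<close>

lemma slash_mult:
  assumes "det A > 0" "det B > 0" "\<tau> \<in> upper_half_plane"
  shows "slash k (A ** B) f \<tau> = slash k B (slash k A f) \<tau>"
proof -
  let ?j = "\<lambda>A \<tau>. of_int (A $ 2 $ 1) * \<tau> + of_int (A $ 2 $ 2) :: complex"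
  let ?n = "\<lambda>A \<tau>. of_int (A $ 1 $ 1) * \<tau> + of_int (A $ 1 $ 2) :: complex"
  have B: "?j B \<tau> \<noteq> 0" using assms(2,3) by (rule moebius_denominator_nonzero)
  have j: "?j (A ** B) \<tau> = ?j A (moebius_act B \<tau>) * ?j B \<tau>"
    and n: "?n (A ** B) \<tau> = ?n A (moebius_act B \<tau>) * ?j B \<tau>"
    using B by (simp_all add: moebius_act_def mat_mult_nth_2 divide_simps) (simp_all add: algebra_simps)
  have "moebius_act (A ** B) \<tau> = ?n (A ** B) \<tau> / ?j (A ** B) \<tau>" by (simp add: moebius_act_def)
  also have "\<dots> = moebius_act A (moebius_act B \<tau>)"
    unfolding j n using B by (simp add: moebius_act_def)
  finally show ?thesis
    unfolding slash_def j by (simp add: det_mul power_int_mult_distrib mult_ac)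
qed

text \<open>Modularity is known only on the upper half plane, so a slashed form cannot be replaced
  by \<open>f\<close> as a function; preservation of the half plane permits it pointwise.\<close>

lemma slash_cong:
  assumes "det A > 0" "\<tau> \<in> upper_half_plane" "\<And>z. z \<in> upper_half_plane \<Longrightarrow> f z = g z"
  shows "slash k A f \<tau> = slash k A g \<tau>"
  using assms moebius_act_upper_half_plane by (simp add: slash_def)

lemma slash_Gamma1_mult:
  assumes "f \<in> cusp_forms k N" "\<gamma> \<in> Gamma1 N" "det A > 0" "\<tau> \<in> upper_half_plane"
  shows "slash k (\<gamma> ** A) f \<tau> = slash k A f \<tau>"
proof -
  have "slash k (\<gamma> ** A) f \<tau> = slash k A (slash k \<gamma> f) \<tau>"
    using assms by (intro slash_mult) (auto simp: Gamma1_iff)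
  also have "\<dots> = slash k A f \<tau>"
    using assms by (intro slash_cong) (auto simp: cusp_forms_def)
  finally show ?thesis .
qed

section \<open>Hecke matrices of prime determinant\<close>

lemma int_prime_dvd_level:
  assumes "prime p" "int p dvd a" "[a = 1] (mod int N)"
  shows "\<not> p dvd N"
proof
  assume "p dvd N"
  then have "[a = 1] (mod int p)" using assms(3) by (meson cong_dvd_modulus of_nat_dvd_iff)
  then have "int p dvd 1" using assms(2) cong_dvd_iff by blast
  then show False using assms(1) by auto
qed

text \<open>The second case is the one where \<open>p\<close> divides the first column of \<open>A\<close>.\<close>

lemma hecke_matrices_cases:
  assumes p: "prime p" and A: "A \<in> hecke_matrices N p"
  obtains (upper) \<gamma> j where "\<gamma> \<in> Gamma1 N" "j < p" "A = \<gamma> ** mat2 1 (int j) 0 (int p)"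
  | (lower) B where "\<not> p dvd N" "det B = 1" "[B $ 1 $ 1 * int p = 1] (mod int N)"
      "[B $ 2 $ 1 = 0] (mod int N)" "A = B ** mat2 (int p) 0 0 1"
proof -
  let ?P = "int p"
  define a b c d where "a = A $ 1 $ 1" "b = A $ 1 $ 2" "c = A $ 2 $ 1" "d = A $ 2 $ 2"
  note abcd = this
  have det: "a * d - b * c = ?P" and a: "[a = 1] (mod int N)" and c: "[c = 0] (mod int N)"
    using A by (auto simp: hecke_matrices_def det_2 abcd)
  have P: "prime ?P" "?P > 0" using p by (auto simp: prime_gt_0_nat)
  show ?thesis
  proof (cases "?P dvd a \<and> ?P dvd c")
    case True
    then obtain a' c' where ac: "a = ?P * a'" "c = ?P * c'" by (auto elim!: dvdE)
    have N: "\<not> p dvd N" using int_prime_dvd_level[OF p _ a] True by blast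
    have "?P * (a' * d - b * c') = ?P * 1" using det by (simp add: ac algebra_simps)
    then have "a' * d - b * c' = 1" using P by (metis mult_cancel_left less_irrefl)
    moreover have "coprime (int N) ?P"
      using N p by (metis coprime_commute coprime_int_iff prime_imp_coprime)
    then have "[c' = 0] (mod int N)"
      using c by (auto simp: ac cong_0_iff coprime_dvd_mult_right_iff)
    \<comment> \<open>Dividing the first column by \<open>p\<close> leaves an upper left entry that
      is inverse to \<open>p\<close> modulo \<open>N\<close>, so \<open>B\<close> lies in
      \<open>Gamma0 N\<close> but in general not in \<open>Gamma1 N\<close>.\<close>
    ultimately show ?thesis
      using N a by (intro lower[of "mat2 a' b c' d"])
        (auto simp: det_2 mat_eq_iff_2 mat_mult_nth_2 ac mult_ac simp flip: abcd)
  next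
    case False
    \<comment> \<open>Modulo \<open>p\<close> the determinant vanishes and the first column does
      not, so the second column is a multiple \<open>j\<close> of the first. An invertible entry of
      the first column gives \<open>j\<close>.\<close>
    have *: "\<exists>j. ?P dvd b - j * a \<and> ?P dvd d - j * c"
    proof (cases "?P dvd a")
      case True
      then have "coprime c ?P" using False P(1) by (metis coprime_commute prime_imp_coprime)
      then obtain i where i: "[c * i = 1] (mod ?P)" using cong_solve_coprime_int by blast
      then have i': "?P dvd c * i - 1" by (simp add: cong_iff_dvd_diff)
      have "c * (b - d * i * a) = - (a * d - b * c) - a * d * (c * i - 1)"
        by (simp add: algebra_simps)
      also have "?P dvd \<dots>" using i' by (simp add: det)
      finally have "?P dvd b - d * i * a"
        using False True P(1) prime_dvd_mult_iff by blast
      moreover have "d - d * i * c = - d * (c * i - 1)" by (simp add: algebra_simps)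
      then have "?P dvd d - d * i * c" using i' by simp
      ultimately show ?thesis by blast
    next
      case a: False
      then have "coprime a ?P" using P(1) by (metis coprime_commute prime_imp_coprime)
      then obtain i where i: "[a * i = 1] (mod ?P)" using cong_solve_coprime_int by blast
      then have i': "?P dvd a * i - 1" by (simp add: cong_iff_dvd_diff)
      have "a * (d - b * i * c) = (a * d - b * c) - b * c * (a * i - 1)"
        by (simp add: algebra_simps)
      also have "?P dvd \<dots>" using i' by (simp add: det)
      finally have "?P dvd d - b * i * c"
        using a P(1) prime_dvd_mult_iff by blast
      moreover have "b - b * i * a = - b * (a * i - 1)" by (simp add: algebra_simps)
      then have "?P dvd b - b * i * a" using i' by simp
      ultimately show ?thesis by blast
    qed
    then obtain j where j: "?P dvd b - j * a" "?P dvd d - j * c" by blast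
    \<comment> \<open>Reducing \<open>j\<close> modulo \<open>p\<close> gives an index in the range
      of the representatives.\<close>
    define m where "m = j mod ?P"
    have "?P dvd b - m * a" "?P dvd d - m * c"
    proof -
      have "?P dvd j - m" by (simp add: m_def)
      then obtain l where "j - m = ?P * l" by (elim dvdE)
      then have l: "j = m + ?P * l" by simp
      have "b - m * a = (b - j * a) + ?P * (l * a)" "d - m * c = (d - j * c) + ?P * (l * c)"
        by (simp_all add: l algebra_simps)
      then show "?P dvd b - m * a" "?P dvd d - m * c"
        using j by (metis dvd_add dvd_triv_left)+
    qed
    then obtain b' d' where "b - m * a = ?P * b'" "d - m * c = ?P * d'" by (elim dvdE)
    then have bd: "b = m * a + ?P * b'" "d = m * c + ?P * d'" by simp_all
    have "?P * (a * d' - b' * c) = ?P * 1" using det by (simp add: bd algebra_simps)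
    then have "a * d' - b' * c = 1" using P by (metis mult_cancel_left less_irrefl)
    then have "mat2 a b' c d' \<in> Gamma1 N" using a c by (simp add: Gamma1_iff det_2)
    moreover have "nat m < p" "int (nat m) = m" using P by (auto simp: m_def nat_less_iff)
    moreover from this have "A = mat2 a b' c d' ** mat2 1 (int (nat m)) 0 ?P"
      by (simp add: mat_eq_iff_2 mat_mult_nth_2 bd mult_ac add_ac flip: abcd)
    ultimately show ?thesis using upper by blast
  qed
qed

lemma moebius_act_upper:
  "moebius_act (mat2 a b 0 d) \<tau> = (of_int a * \<tau> + of_int b) / of_int d"
  by (simp add: moebius_act_def)

text \<open>The determinant contributes \<open>p^(k - 1)\<close> and the automorphy factor
  \<open>p^(-k)\<close>.\<close>

lemma slash_upper_prime:
  assumes "p > 0"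
  shows "slash k (mat2 1 (int j) 0 (int p)) f \<tau> = f ((\<tau> + of_nat j) / of_nat p) / of_nat p"
proof -
  have "(of_nat p :: complex) powi (int k - 1) * of_nat p powi (- int k) = inverse (of_nat p)"
    using assms by (simp flip: power_int_add)
  then show ?thesis
    by (simp add: slash_def det_2 moebius_act_upper divide_inverse mult.commute)
qed

lemma slash_scaling:
  assumes "k > 0"
  shows "slash k (mat2 (int p) 0 0 1) f \<tau> = of_nat p ^ (k - 1) * f (of_nat p * \<tau>)"
proof -
  have "int k - 1 = int (k - 1)" using assms by simp
  then show ?thesis by (simp add: slash_def det_2 moebius_act_upper del: of_nat_diff)
qed

text \<open>Multiplied by \<open>diag(p, 1)\<close> on the right, \<open>S\<close> yields the
  representative of the one remaining coset for \<open>p\<close> not dividing \<open>N\<close>. Its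
  lower right entry makes \<open>S\<close> act on forms with character as multiplication by the
  value at \<open>p\<close>.\<close>

lemma ex_hecke_lower_matrix:
  assumes "prime p" "\<not> p dvd N"
  shows "\<exists>S\<in>Gamma0 N. S $ 2 $ 2 = int p \<and> [S $ 1 $ 1 * int p = 1] (mod int N)"
proof -
  have "coprime (int p) (int N)"
    using assms by (simp add: prime_imp_coprime)
  then obtain m where m: "[int p * m = 1] (mod int N)" using cong_solve_coprime_int by blast
  then obtain n where n: "int p * m - 1 = int N * n" unfolding cong_iff_dvd_diff by (auto elim: dvdE)
  let ?S = "mat2 m n (int N) (int p)"
  have "?S \<in> Gamma0 N" using n by (simp add: Gamma0_def SL2Z_def det_2 cong_0_iff algebra_simps)
  then show ?thesis using m by (intro bexI[of _ ?S]) (auto simp: mult.commute)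
qed

text \<open>The classical formula \<open>T_p = U_p + p^(k - 1) V_p\<close>, the second term being
  absent when \<open>p\<close> divides \<open>N\<close>. The upper triangular representatives give
  \<open>U_p\<close> and the extra coset gives \<open>V_p\<close>.\<close>

lemma hecke_op_prime:
  assumes p: "prime p" and k: "k > 0" and f: "f \<in> cusp_forms_char k N (trivial_character N)"
    and \<tau>: "\<tau> \<in> upper_half_plane"
  shows "hecke_op k N p f \<tau> =
    (\<Sum>j<p. f ((\<tau> + of_nat j) / of_nat p)) / of_nat p +
    (if p dvd N then 0 else of_nat p ^ (k - 1) * f (of_nat p * \<tau>))"
proof -
  have p0: "p > 0" "p > 1" using p prime_gt_0_nat prime_gt_1_nat by auto
  have fc: "f \<in> cusp_forms k N" using f by (simp add: cusp_forms_char_def)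
  let ?U = "\<lambda>j. mat2 1 (int j) 0 (int p)" and ?\<delta> = "mat2 (int p) 0 0 1"
  let ?X = "hecke_matrices N p" and ?\<phi> = "\<lambda>A. slash k A f \<tau>"
  have inv: "?\<phi> (\<gamma> ** A) = ?\<phi> A" if "\<gamma> \<in> Gamma1 N" "A \<in> ?X" for \<gamma> A
    using that p0 \<tau> by (intro slash_Gamma1_mult[OF fc]) (auto simp: hecke_matrices_def)
  have UX: "?U j \<in> ?X" for j by (simp add: hecke_matrices_def det_2)
  have U_unique: "r = r'" if r: "r \<in> ?U ` {..<p}" "r' \<in> ?U ` {..<p}" "r' = \<gamma> ** r" for r r' \<gamma>
  proof -
    obtain j where j: "j < p" "r = ?U j" using r(1) by (elim imageE) simp
    obtain j' where j': "j' < p" "r' = ?U j'" using r(2) by (elim imageE) simp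
    have g: "\<gamma> $ 1 $ 1 = 1" "int j' = \<gamma> $ 1 $ 1 * int j + \<gamma> $ 1 $ 2 * int p"
      using r(3) by (simp_all add: j(2) j'(2) mat_eq_iff_2 mat_mult_nth_2)
    then have "int j' mod int p = int j mod int p" by simp
    then have "j' = j" using j(1) j'(1) by (simp flip: of_nat_mod)
    then show ?thesis using j(2) j'(2) by simp
  qed
  have injU: "inj_on ?U {..<p}"
    by (rule inj_onI) (simp add: mat_eq_iff_2)
  have sumU: "sum ?\<phi> (?U ` {..<p}) = (\<Sum>j<p. f ((\<tau> + of_nat j) / of_nat p)) / of_nat p"
    by (simp add: sum.reindex[OF injU] slash_upper_prime[OF p0(1)] sum_divide_distrib)
  show ?thesis
  proof (cases "p dvd N")
    case True
    have "coset_sum (Gamma1 N) ?X ?\<phi> = sum ?\<phi> (?U ` {..<p})"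
    proof (rule coset_sum_eq_sum[OF Gamma1_one Gamma1_mult Gamma1_inverse])
      show "\<exists>r\<in>?U ` {..<p}. \<exists>\<gamma>\<in>Gamma1 N. A = \<gamma> ** r" if "A \<in> ?X" for A
        using p that by (cases rule: hecke_matrices_cases) (use True in auto)
      show "r = r'" if "r \<in> ?U ` {..<p}" "r' \<in> ?U ` {..<p}" "r' = \<gamma> ** r" for r r' \<gamma>
        using that by (rule U_unique)
      show "?U ` {..<p} \<subseteq> ?X" using UX by (rule image_subsetI)
    qed (assumption | rule inv)+
    then show ?thesis using True by (simp add: hecke_op_def sumU)
  next
    case False
    obtain S where S: "S \<in> Gamma0 N" "S $ 2 $ 2 = int p" "[S $ 1 $ 1 * int p = 1] (mod int N)"
      using ex_hecke_lower_matrix[OF p False] by blast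
    have dS: "det S = 1" and S21: "[S $ 2 $ 1 = 0] (mod int N)"
      using S(1) by (auto simp: Gamma0_def SL2Z_def)
    let ?L = "S ** ?\<delta>"
    \<comment> \<open>Divisibility of the first column by \<open>p\<close> survives multiplication
      from the left, whereas \<open>?U j\<close> has upper left entry 1; this separates the extra
      coset from the others.\<close>
    have L1: "int p dvd (\<gamma> ** ?L) $ 1 $ 1" for \<gamma> :: "int^2^2"
    proof -
      have "(\<gamma> ** ?L) $ 1 $ 1 = int p * (\<gamma> $ 1 $ 1 * S $ 1 $ 1 + \<gamma> $ 1 $ 2 * S $ 2 $ 1)"
        by (simp add: mat_mult_nth_2 algebra_simps)
      then show ?thesis by simp
    qed
    have L_ne_U: "\<gamma> ** ?L \<noteq> ?U j" for \<gamma> j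
      using L1[of \<gamma>] p0 by auto
    have U_ne_L: "\<gamma> ** ?U j \<noteq> ?L" if "\<gamma> \<in> Gamma1 N" for \<gamma> j
    proof
      assume *: "\<gamma> ** ?U j = ?L"
      obtain \<gamma>' where "\<gamma>' ** \<gamma> = mat 1" using Gamma1_inverse[OF \<open>\<gamma> \<in> Gamma1 N\<close>] by blast
      then have "\<gamma>' ** ?L = ?U j" by (simp add: matrix_mul_assoc flip: *)
      then show False using L_ne_U by blast
    qed
    have L_notin: "?L \<notin> ?U ` {..<p}" using L_ne_U[of "mat 1"] by auto
    have L: "?L \<in> ?X"
    proof -
      have "[S $ 2 $ 1 * int p = 0 * int p] (mod int N)" using S21 by (rule cong_scalar_right)
      then show ?thesis
        using S dS by (simp add: hecke_matrices_def det_mul mat_mult_nth_2) (simp add: det_2)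
    qed
    have "coset_sum (Gamma1 N) ?X ?\<phi> = sum ?\<phi> (insert ?L (?U ` {..<p}))"
    proof (rule coset_sum_eq_sum[OF Gamma1_one Gamma1_mult Gamma1_inverse])
      show "\<exists>r\<in>insert ?L (?U ` {..<p}). \<exists>\<gamma>\<in>Gamma1 N. A = \<gamma> ** r" if "A \<in> ?X" for A
        using p that
      proof (cases rule: hecke_matrices_cases)
        case (upper \<gamma> j)
        then show ?thesis by auto
      next
        case (lower B)
        \<comment> \<open>\<open>?T\<close> is the adjugate of \<open>S\<close>, hence its inverse.
          In \<open>B ** ?T\<close> the inverse of \<open>p\<close> in the corner of
          \<open>B\<close> meets the entry \<open>p\<close> of \<open>S\<close>, which restores the
          congruences of \<open>Gamma1 N\<close>.\<close>
        let ?T = "mat2 (S $ 2 $ 2) (- S $ 1 $ 2) (- S $ 2 $ 1) (S $ 1 $ 1)"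
        have T: "?T ** S = mat 1"
          using dS by (simp add: det_2 mat_eq_iff_2 mat_mult_nth_2 algebra_simps)
            (simp add: mat_def algebra_simps)
        have "B ** ?T \<in> Gamma1 N"
        proof -
          have "[B $ 1 $ 1 * int p + B $ 1 $ 2 * - S $ 2 $ 1 = 1 + B $ 1 $ 2 * 0] (mod int N)"
            "[B $ 2 $ 1 * int p + B $ 2 $ 2 * - S $ 2 $ 1 = 0 * int p + B $ 2 $ 2 * 0] (mod int N)"
            using lower S21 by (intro cong_add cong_mult; auto simp: cong_0_iff)+
          moreover have "det ?T = 1" using dS by (simp add: det_2 mult.commute)
          ultimately show ?thesis
            using lower(2) S(2) by (simp add: Gamma1_iff det_mul mat_mult_nth_2)
        qed
        moreover have "A = (B ** ?T) ** ?L"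
          using lower(5) T by (metis matrix_mul_assoc matrix_mul_lid)
        ultimately show ?thesis by blast
      qed
      show "r = r'" if "r \<in> insert ?L (?U ` {..<p})" "r' \<in> insert ?L (?U ` {..<p})"
        "\<gamma> \<in> Gamma1 N" "r' = \<gamma> ** r" for r r' \<gamma>
        using that(1)
      proof
        assume r: "r = ?L"
        then have "r' \<notin> ?U ` {..<p}" using L_ne_U[of \<gamma>] that(4) by (auto dest: sym)
        then show ?thesis using r that(2) by simp
      next
        assume r: "r \<in> ?U ` {..<p}"
        then have "r' \<noteq> ?L" using U_ne_L[OF that(3)] that(4) by (elim imageE) simp
        then have "r' \<in> ?U ` {..<p}" using that(2) by simp
        with r show ?thesis using that(4) by (rule U_unique)
      qed
      show "insert ?L (?U ` {..<p}) \<subseteq> ?X" using L UX by (intro insert_subsetI image_subsetI)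
    qed (assumption | rule inv)+
    also have "\<dots> = ?\<phi> ?L + sum ?\<phi> (?U ` {..<p})" using L_notin by simp
    also have "?\<phi> ?L = slash k ?\<delta> (slash k S f) \<tau>"
      using dS p0 \<tau> by (intro slash_mult) (auto simp: det_2)
    \<comment> \<open>\<open>S\<close> acts trivially because the trivial character is 1 at
      \<open>p\<close>.\<close>
    also have "\<dots> = slash k ?\<delta> f \<tau>"
    proof (rule slash_cong)
      have "coprime (int p) (int N)" using p False by (simp add: prime_imp_coprime)
      then show "slash k S f z = f z" if "z \<in> upper_half_plane" for z
        using f S that by (simp add: cusp_forms_char_def trivial_character_def)
    qed (use p0 \<tau> in \<open>auto simp: det_2\<close>)
    also have "\<dots> = of_nat p ^ (k - 1) * f (of_nat p * \<tau>)" using k by (rule slash_scaling)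
    finally show ?thesis using False by (simp add: hecke_op_def sumU)
  qed
qed

subsection \<open>Action on Fourier coefficients\<close>

lemma sum_roots_of_unity_powers:
  assumes "p > 0"
  shows "(\<Sum>j<p. exp (2 * of_real pi * \<i> * of_nat n / of_nat p) ^ j) = (if p dvd n then of_nat p else 0)"
proof -
  define w where "w = exp (2 * of_real pi * \<i> * of_nat n / of_nat p)"
  have w1: "w = 1 \<longleftrightarrow> p dvd n"
    using complex_root_unity_eq_1[of p n] assms by (simp add: w_def)
  have "w ^ p = exp (2 * of_real pi * \<i> * of_nat n)"
    using assms by (simp add: w_def flip: exp_of_nat_mult)
  also have "\<dots> = 1" using complex_root_unity_eq_1[of 1 n] by simp
  finally have "w ^ p = 1" .
  then show ?thesis unfolding w_def[symmetric] using w1 by (auto simp: sum_gp_strict)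
qed

lemma upper_half_plane_scale:
  assumes "p > 0" "\<tau> \<in> upper_half_plane"
  shows "(\<tau> + of_nat j) / of_nat p \<in> upper_half_plane" "of_nat p * \<tau> \<in> upper_half_plane"
  using assms by (simp_all add: upper_half_plane_def)

text \<open>Averaging over the translates is a roots of unity filter: it keeps exactly the terms
  whose index is divisible by \<open>p\<close>.\<close>

lemma has_q_expansion_hecke_U:
  assumes p: "p > 0" and f: "has_q_expansion 1 f a"
  shows "has_q_expansion 1 (\<lambda>\<tau>. (\<Sum>j<p. f ((\<tau> + of_nat j) / of_nat p)) / of_nat p) (\<lambda>n. a (p * n))"
  unfolding has_q_expansion_def
proof
  fix \<tau> assume \<tau>: "\<tau> \<in> upper_half_plane"
  \<comment> \<open>\<open>Q\<close> is a \<open>p\<close>-th root of the local parameter at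
    \<open>\<tau>\<close>, and each translate multiplies it by a root of unity.\<close>
  define Q where "Q = q_param 1 (\<tau> / of_nat p)"
  let ?w = "\<lambda>n. exp (2 * of_real pi * \<i> * of_nat n / of_nat p)"
  have Qp: "Q ^ p = q_param 1 \<tau>"
    using p by (simp add: Q_def q_param_def flip: exp_of_nat_mult)
  have q: "q_param 1 ((\<tau> + of_nat j) / of_nat p) ^ n = Q ^ n * ?w n ^ j" for j n
    by (simp add: Q_def q_param_def add_divide_distrib ring_distribs mult_ac
        flip: exp_of_nat_mult exp_add)
  have "(\<lambda>n. (\<Sum>j<p. a n * q_param 1 ((\<tau> + of_nat j) / of_nat p) ^ n) / of_nat p)
      sums ((\<Sum>j<p. f ((\<tau> + of_nat j) / of_nat p)) / of_nat p)"
    using f upper_half_plane_scale(1)[OF p \<tau>]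
    by (intro sums_divide sums_sum) (auto simp: has_q_expansion_def)
  also have "(\<lambda>n. (\<Sum>j<p. a n * q_param 1 ((\<tau> + of_nat j) / of_nat p) ^ n) / of_nat p) =
      (\<lambda>n. if p dvd n then a n * Q ^ n else 0)"
  proof
    fix n
    have "(\<Sum>j<p. a n * q_param 1 ((\<tau> + of_nat j) / of_nat p) ^ n) = a n * Q ^ n * (\<Sum>j<p. ?w n ^ j)"
      unfolding q sum_distrib_left by (simp add: mult.assoc)
    then show "(\<Sum>j<p. a n * q_param 1 ((\<tau> + of_nat j) / of_nat p) ^ n) / of_nat p =
        (if p dvd n then a n * Q ^ n else 0)"
      using p by (simp add: sum_roots_of_unity_powers)
  qed
  finally have s: "(\<lambda>n. if p dvd n then a n * Q ^ n else 0)
      sums ((\<Sum>j<p. f ((\<tau> + of_nat j) / of_nat p)) / of_nat p)" .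
  have "(\<lambda>n. if p dvd p * n then a (p * n) * Q ^ (p * n) else 0)
      sums ((\<Sum>j<p. f ((\<tau> + of_nat j) / of_nat p)) / of_nat p)"
    by (subst sums_mono_reindex[of "\<lambda>n. p * n" "\<lambda>n. if p dvd n then a n * Q ^ n else 0"])
       (use p s in \<open>auto simp: strict_mono_def\<close>)
  then show "(\<lambda>n. a (p * n) * q_param 1 \<tau> ^ n)
      sums ((\<Sum>j<p. f ((\<tau> + of_nat j) / of_nat p)) / of_nat p)"
    by (simp add: power_mult Qp)
qed

text \<open>Scaling the argument by \<open>p\<close> replaces \<open>q\<close> by
  \<open>q^p\<close>; the reindexing along multiples of \<open>p\<close> skips only zero
  terms.\<close>

lemma has_q_expansion_scale:
  assumes p: "p > 0" and f: "has_q_expansion 1 f a"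
  shows "has_q_expansion 1 (\<lambda>\<tau>. f (of_nat p * \<tau>)) (\<lambda>n. if p dvd n then a (n div p) else 0)"
  unfolding has_q_expansion_def
proof
  fix \<tau> assume \<tau>: "\<tau> \<in> upper_half_plane"
  let ?b = "\<lambda>n. if p dvd n then a (n div p) else 0"
  have q: "q_param 1 (of_nat p * \<tau>) = q_param 1 \<tau> ^ p"
    by (simp add: q_param_def mult_ac flip: exp_of_nat_mult)
  have "(\<lambda>n. a n * q_param 1 (of_nat p * \<tau>) ^ n) sums f (of_nat p * \<tau>)"
    using f upper_half_plane_scale(2)[OF p \<tau>] by (auto simp: has_q_expansion_def)
  then have s: "(\<lambda>n. ?b (p * n) * q_param 1 \<tau> ^ (p * n)) sums f (of_nat p * \<tau>)"
    using p by (simp add: q power_mult del: One_nat_def)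
  show "(\<lambda>n. ?b n * q_param 1 \<tau> ^ n) sums f (of_nat p * \<tau>)"
    by (subst sums_mono_reindex[of "\<lambda>n. p * n" "\<lambda>n. ?b n * q_param 1 \<tau> ^ n", symmetric])
       (use p s in \<open>auto simp: strict_mono_def\<close>)
qed

lemma has_q_expansion_add:
  assumes "has_q_expansion h f a" "has_q_expansion h g b"
  shows "has_q_expansion h (\<lambda>\<tau>. f \<tau> + g \<tau>) (\<lambda>n. a n + b n)"
  using assms by (simp add: has_q_expansion_def distrib_right sums_add)

lemma has_q_expansion_cmult:
  assumes "has_q_expansion h f a"
  shows "has_q_expansion h (\<lambda>\<tau>. c * f \<tau>) (\<lambda>n. c * a n)"
  using assms by (simp add: has_q_expansion_def mult.assoc sums_mult)

text \<open>Both sides of \<open>T_p f = c f\<close> have \<open>q\<close>-expansions, whose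
  coefficients agree by uniqueness.\<close>

lemma fourier_coeff_prime_mult:
  assumes N: "N \<ge> 1" and k: "k > 0" and p: "prime p"
    and f: "primitive_form k N (trivial_character N) f"
  shows "fourier_coeff f p * fourier_coeff f n = fourier_coeff f (p * n) +
    (if \<not> p dvd N \<and> p dvd n then of_nat p ^ (k - 1) * fourier_coeff f (n div p) else 0)"
proof -
  let ?a = "fourier_coeff f"
  let ?b = "\<lambda>n. ?a (p * n) +
    (if p dvd N then 0 else of_nat p ^ (k - 1)) * (if p dvd n then ?a (n div p) else 0)"
  have p1: "p > 1" using p by (rule prime_gt_1_nat)
  have fc: "f \<in> cusp_forms_char k N (trivial_character N)" and a1: "?a 1 = 1"
    using f by (auto simp: primitive_form_def)
  then have "f \<in> cusp_forms k N" by (simp add: cusp_forms_char_def)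
  then have a: "has_q_expansion 1 f ?a" by (rule cusp_form_q_expansion(1)[OF N])
  have "eigenform_of (hecke_op k N p) f" using f p1 by (auto simp: primitive_form_def)
  then obtain c where c: "\<And>\<tau>. \<tau> \<in> upper_half_plane \<Longrightarrow> hecke_op k N p f \<tau> = c * f \<tau>"
    by (auto simp: eigenform_of_def)
  let ?T = "\<lambda>\<tau>. (\<Sum>j<p. f ((\<tau> + of_nat j) / of_nat p)) / of_nat p +
    (if p dvd N then 0 else of_nat p ^ (k - 1)) * f (of_nat p * \<tau>)"
  have "has_q_expansion 1 ?T ?b"
    using p1 a by (intro has_q_expansion_add has_q_expansion_cmult
        has_q_expansion_hecke_U has_q_expansion_scale) auto
  moreover have "?T \<tau> = c * f \<tau>" if "\<tau> \<in> upper_half_plane" for \<tau>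
    using c[OF that] hecke_op_prime[OF p k fc that] by (auto split: if_splits)
  ultimately have "has_q_expansion 1 (\<lambda>\<tau>. c * f \<tau>) ?b"
    by (simp add: has_q_expansion_def)
  then have "?b = (\<lambda>n. c * ?a n)"
    using has_q_expansion_cmult[OF a] has_q_expansion_unique[of 1] by blast
  then have b: "?b m = c * ?a m" for m by (rule fun_cong)
  \<comment> \<open>At index 1 the \<open>V_p\<close> term drops out, and the normalisation
    \<open>?a 1 = 1\<close> identifies the eigenvalue.\<close>
  have "c = ?a p" using b[of 1] a1 p1 by simp
  then show ?thesis using b[of n] by auto
qed

theorem proposition3p6:
  fixes N k :: nat and \<psi> :: "int \<Rightarrow> complex" and f :: "complex \<Rightarrow> complex"
  assumes "N \<ge> 1" and "k > 0" and "even k"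
    and "dirichlet_character N \<psi>"
    and "primitive_form k N \<psi> f"
    and "\<psi> = trivial_character N"
    and "\<And>n. n \<ge> 1 \<Longrightarrow> fourier_coeff f n \<in> \<int>"
  shows "\<exists>M::nat. M \<ge> 1 \<and> gcd M N = 1 \<and> M dvd 6 \<and>
    (\<forall>p. prime p \<and> \<not> p dvd M \<longrightarrow>
       fourier_coeff f p = 0 \<or> (\<forall>r\<ge>1. fourier_coeff f (p ^ r) \<noteq> 0))"
proof -
  define M where "M = (if 2 dvd N then 1 else 2) * (if 3 dvd N then 1 else 3 :: nat)"
  have "coprime (2::nat) N" if "\<not> 2 dvd N"
    using that by (intro prime_imp_coprime) auto
  moreover have "coprime (3::nat) N" if "\<not> 3 dvd N"
    using that by (intro prime_imp_coprime) auto
  ultimately have "coprime M N" by (auto simp: M_def simp del: coprime_left_2_iff_odd)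
  then have "gcd M N = 1" by simp
  moreover have "M \<ge> 1" "M dvd 6" by (auto simp: M_def)
  moreover have "fourier_coeff f p = 0 \<or> (\<forall>r\<ge>1. fourier_coeff f (p ^ r) \<noteq> 0)"
    if p: "prime p" "\<not> p dvd M" for p
  proof -
    have p1: "p > 1" using p(1) by (rule prime_gt_1_nat)
    have "\<exists>z. fourier_coeff f (p ^ r) = of_int z" for r
      using assms(7)[of "p ^ r"] p1 by (auto elim: Ints_cases)
    \<comment> \<open>Passing to an integer sequence makes the divisibility arguments
      available.\<close>
    then obtain u where u: "\<And>r. fourier_coeff f (p ^ r) = of_int (u r)" by metis
    have prim: "primitive_form k N (trivial_character N) f" using assms by simp
    have mult: "fourier_coeff f p * fourier_coeff f n = fourier_coeff f (p * n) +
        (if \<not> p dvd N \<and> p dvd n then of_nat p ^ (k - 1) * fourier_coeff f (n div p) else 0)" for n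
      using assms(1,2) p(1) prim by (rule fourier_coeff_prime_mult)
    have u0: "u 0 = 1" using u[of 0] prim by (simp add: primitive_form_def)
    have up: "fourier_coeff f p = of_int (u 1)" using u[of 1] by simp
    have "u r \<noteq> 0" if A: "u 1 \<noteq> 0" for r
    proof (cases "p dvd N")
      case True
      have "of_int (u 1) * of_int (u r) = (of_int (u (Suc r)) :: complex)" for r
        using mult[of "p ^ r"] True up u[of r] u[of "Suc r"] by simp
      then have step: "u (Suc r) = u 1 * u r" for r by (metis of_int_eq_iff of_int_mult)
      have "u r = u 1 ^ r" by (induction r) (simp_all add: u0 step del: One_nat_def)
      then show ?thesis using A by simp
    next
      case False
      \<comment> \<open>If 2 or 3 does not divide \<open>N\<close>, it is a factor of
        \<open>M\<close>, which \<open>p\<close> does not divide.\<close>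
      have "p \<noteq> 2" "p \<noteq> 3" using p(2) False by (auto simp: M_def)
      then have p4: "p \<ge> 4" using p1 by simp
      have "u (r + 2) = u 1 * u (r + 1) - int p ^ (k - 1) * u r" for r
      proof -
        \<comment> \<open>The relation is used at index \<open>p ^ (r + 1)\<close>, which
          \<open>p\<close> divides, so that the correction term is present.\<close>
        have "p ^ (r + 1) div p = p ^ r" using p1 by simp
        then have "of_int (u 1) * of_int (u (r + 1)) =
            (of_int (u (r + 2)) + of_nat p ^ (k - 1) * of_int (u r) :: complex)"
          using mult[of "p ^ (r + 1)"] False up u[of r] u[of "r + 1"] u[of "r + 2"] by simp
        then have "of_int (u 1 * u (r + 1)) =
            (of_int (u (r + 2) + int p ^ (k - 1) * u r) :: complex)" by simp
        then show ?thesis unfolding of_int_eq_iff by simp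
      qed
      then show ?thesis
        using lucas_nonzero[of "int p" "k - 1" "u 1" u r] p(1) p4 u0 A assms(2,3) by auto
    qed
    then show ?thesis using up u by (metis of_int_eq_0_iff)
  qed
  ultimately show ?thesis by (intro exI[of _ M] conjI allI impI) simp_all
qed

end
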